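(* For any integer $n\geq 1$, we have \[ |\mathsf{BP}_n^0| = \sum_{i=1}^{p(n)} \frac{n!}{\prod_{j=1}^{d(i)} \left(m(i,j)!\right)^j} = \sum_{i=1}^{p(n)} \prod_{j=1}^{d(i)} \prod_{\ell=1}^{j} \binom{n-\sum_{k=1}^{j-1} k\cdot m(i,k)-(\ell-1)\cdot m(i,j)}{m(i,j)} \] \[ = \sum_{i=1}^{p(n)} \prod_{j=1}^{d(i)} \left( \binom{n-\sum_{k=1}^{j-1} k\cdot m(i,k)}{j\cdot m(i,j)} \cdot \prod_{\ell=1}^{j} \binom{(j-\ell+1)\cdot m(i,j)}{m(i,j)} \right). \]
   Context: Notation: $\llbracket n\rrbracket=\{0,\dots,n-1\}$. A partitioned order of $\llbracket n\rrbracket$ is an (unordered) set $\{S_k\}_{k\in\llbracket s\rrbracket}$ of $s$ sequences $S_k=(i^k_0,\dots,i^k_{n_k-1})$ with $n_k>0$, each consisting of pairwise distinct elements of $\llbracket n\rrbracket$, the sequences being pairwise disjoint (as sets of entries) with union $\llbracket n\rrbracket$; so every element of $\llbracket n\rrbracket$ occurs at exactly one position of exactly one sequence. A block-parallel update mode of size $n$ is a partitioned order of $\llbracket n\rrbracket$; its sequences are called o-blocks. The set of all of them is $\mathsf{BP}_n$. For $\mu=\{S_k\}_{k\in\llbracket s\rrbracket}\in\mathsf{BP}_n$, let $p=\mathrm{lcm}(n_0,\dots,n_{s-1})$ and define the sequence of blocks $\varphi(\mu)=(W_\ell)_{\ell\in\llbracket p\rrbracket}$ by $W_\ell=\{i^k_{\ell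 \bmod n_k}\mid k\in\llbracket s\rrbracket\}$. Equivalence: for $\mu,\mu'\in\mathsf{BP}_n$, $\mu\equiv_0\mu'$ means $\varphi(\mu)=\varphi(\mu')$ (equality of sequences of sets). $\mathsf{BP}_n^0=\mathsf{BP}_n/\equiv_0$ is the quotient set. Integer partitions: $p(n)$ is the number of integer partitions of $n$ (multisets of positive integers summing to $n$), listed in some fixed order as partitions number $1,\dots,p(n)$; $d(i)$ is the maximal part size of the $i$-th partition, and $m(i,j)$ is the multiplicity of the part of size $j$ in the $i$-th partition (possibly $0$). *)

theory Defs
  imports Complex_Main "HOL-Library.Multiset"
begin

text \<open>
  A sequence of elements of \<open>{0, \<dots>, n - 1}\<close> is a list. As the sequences of a partitioned order
  are nonempty and pairwise disjoint, they are pairwise distinct, so a set of lists represents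
  an unordered family of sequences without loss, and it is automatically finite.
\<close>

definition BP :: "nat \<Rightarrow> nat list set set" where
  "BP n = {\<mu>. (\<forall>S\<in>\<mu>. S \<noteq> [] \<and> distinct S) \<and>
              pairwise (\<lambda>S T. disjnt (set S) (set T)) \<mu> \<and>
              (\<Union>S\<in>\<mu>. set S) = {..<n}}"

definition block_sequence :: "nat list set \<Rightarrow> nat set list" where
  "block_sequence \<mu> =
     map (\<lambda>l. (\<lambda>S. S ! (l mod length S)) ` \<mu>) [0..<Lcm (length ` \<mu>)]"

definition equiv0 :: "nat \<Rightarrow> (nat list set \<times> nat list set) set" where
  "equiv0 n = {(\<mu>, \<mu>'). \<mu> \<in> BP n \<and> \<mu>' \<in> BP n \<and> block_sequence \<mu> = block_sequence \<mu>'}"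

definition BP0 :: "nat \<Rightarrow> nat list set set set" where
  "BP0 n = BP n // equiv0 n"

definition integer_partitions :: "nat \<Rightarrow> nat multiset set" where
  "integer_partitions n = {M. (\<forall>k\<in>#M. k > 0) \<and> sum_mset M = n}"

definition num_partitions :: "nat \<Rightarrow> nat" where
  "num_partitions n = card (integer_partitions n)"

definition max_part :: "nat multiset \<Rightarrow> nat" where
  "max_part M = Max (set_mset M)"

text \<open>A listing numbers the integer partitions of \<open>n\<close> from \<open>1\<close> in an arbitrary order.\<close>

definition partition_listing :: "nat \<Rightarrow> (nat \<Rightarrow> nat multiset) \<Rightarrow> bool" where
  "partition_listing n P \<longleftrightarrow> bij_betw P {1..num_partitions n} (integer_partitions n)"

lemma size_le_sum_mset:
  fixes M :: "nat multiset"
  assumes "\<forall>k\<in>#M. k > 0"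
  shows "size M \<le> sum_mset M"
  using assms by (induction M) auto

lemma finite_integer_partitions: "finite (integer_partitions n)"
proof -
  have "integer_partitions n \<subseteq> mset ` {xs. set xs \<subseteq> {..n} \<and> length xs \<le> n}"
  proof
    fix M assume M: "M \<in> integer_partitions n"
    obtain xs where xs: "mset xs = M" using ex_mset by blast
    have "length xs \<le> n"
      using M size_le_sum_mset[of M] xs by (auto simp: integer_partitions_def)
    moreover have "set xs \<subseteq> {..n}"
      using M xs member_le_sum_list[of _ xs]
      by (auto simp: integer_partitions_def sum_mset_sum_list)
    ultimately show "M \<in> mset ` {xs. set xs \<subseteq> {..n} \<and> length xs \<le> n}"
      using xs by blast
  qed
  then show ?thesis
    using finite_lists_length_le[of "{..n}" n] finite_surj by blast
qed

lemma ex_partition_listing: "\<exists>P. partition_listing n P"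
  using ex_bij_betw_nat_finite_1[OF finite_integer_partitions[of n]]
  by (simp add: partition_listing_def num_partitions_def)

end

theory Submission
  imports Defs "HOL-Combinatorics.Multiset_Permutations"
begin

text \<open>
  Let the slot of an element be the pair (length of its o-block, position in its o-block).
  The block sequence determines the slot of every element: an element with slot \<open>(j, l)\<close> lies
  exactly in the blocks with index congruent to \<open>l\<close> modulo \<open>j\<close>, and \<open>j\<close> divides the length of
  the sequence. Conversely, the slots determine the block sequence. Hence the equivalence classes
  correspond to the words of slots of length \<open>n\<close> in which, for each \<open>j\<close>, all \<open>j\<close> slots
  \<open>(j, 0), \<dots>, (j, j - 1)\<close> occur equally often, say \<open>m j\<close> times. Such a word is a permutation of a
  multiset determined by the partition of \<open>n\<close> with multiplicities \<open>m\<close>, so the words are counted by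
  multinomial coefficients.
\<close>

section \<open>Slots and block sequences\<close>

text \<open>The description is unique for entries of the o-blocks of a partitioned order; for other
  numbers the value is unspecified.\<close>

definition slot :: "nat list set \<Rightarrow> nat \<Rightarrow> nat \<times> nat" where
  "slot \<mu> x = (THE p. \<exists>S\<in>\<mu>. \<exists>l<length S. S ! l = x \<and> p = (length S, l))"

text \<open>Stopping at \<open>n\<close> leaves out the unspecified values of \<open>slot\<close>,
  so that equal words mean equal genuine slots. As lists, the words can be counted as permutations
  of a multiset.\<close>

definition slot_word :: "nat \<Rightarrow> nat list set \<Rightarrow> (nat \<times> nat) list" where
  "slot_word n \<mu> = map (slot \<mu>) [0..<n]"

lemma BP_D:
  assumes "\<mu> \<in> BP n"
  shows "S \<in> \<mu> \<Longrightarrow> S \<noteq> []" "S \<in> \<mu> \<Longrightarrow> distinct S"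
    and "pairwise (\<lambda>S T. disjnt (set S) (set T)) \<mu>" "(\<Union>S\<in>\<mu>. set S) = {..<n}"
  using assms by (auto simp: BP_def)

lemma finite_BP:
  assumes "\<mu> \<in> BP n"
  shows "finite \<mu>"
proof -
  have "\<mu> \<subseteq> {S. set S \<subseteq> {..<n} \<and> distinct S}"
    using BP_D[OF assms] by blast
  then show ?thesis
    by (rule finite_subset) (simp add: finite_subset_distinct)
qed

lemma BP_nth_eqD:
  assumes "\<mu> \<in> BP n" "S \<in> \<mu>" "T \<in> \<mu>" "l < length S" "k < length T" "S ! l = T ! k"
  shows "S = T \<and> l = k"
proof -
  have "S ! l \<in> set S \<inter> set T"
    using assms by (metis IntI nth_mem)
  then have "S = T"
    using BP_D(3)[OF assms(1)] assms(2,3) by (auto simp: pairwise_def disjnt_def)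
  then show ?thesis
    using assms BP_D(2)[OF assms(1,2)] by (simp add: nth_eq_iff_index_eq)
qed

lemma slot_nth:
  assumes "\<mu> \<in> BP n" "S \<in> \<mu>" "l < length S"
  shows "slot \<mu> (S ! l) = (length S, l)"
  unfolding slot_def
proof (rule the_equality)
  show "\<exists>T\<in>\<mu>. \<exists>k<length T. T ! k = S ! l \<and> (length S, l) = (length T, k)"
    using assms by blast
qed (use BP_nth_eqD[OF assms(1) _ assms(2) _ assms(3)] in blast)

lemma BP_slotE:
  assumes "\<mu> \<in> BP n" "x < n"
  obtains S l where "S \<in> \<mu>" "l < length S" "x = S ! l" "slot \<mu> x = (length S, l)"
proof -
  have "x \<in> (\<Union>S\<in>\<mu>. set S)"
    using assms BP_D(4) by simp
  then obtain S l where "S \<in> \<mu>" "l < length S" "x = S ! l"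
    by (auto simp: in_set_conv_nth)
  then show thesis
    using that slot_nth[OF assms(1)] by blast
qed

lemma BP_nth_less:
  assumes "\<mu> \<in> BP n" "S \<in> \<mu>" "l < length S"
  shows "S ! l < n"
  using BP_D(4)[OF assms(1)] assms(2,3) nth_mem by blast

text \<open>The period must be readable from the slots too. An o-block is nonempty, so its length
  shows in the slot of its first entry.\<close>

lemma length_image_eq_slots:
  assumes "\<mu> \<in> BP n"
  shows "length ` \<mu> = fst ` slot \<mu> ` {..<n}"
proof -
  have "length S \<in> fst ` slot \<mu> ` {..<n}" if "S \<in> \<mu>" for S
  proof -
    have "0 < length S" using BP_D(1)[OF assms that] by simp
    with slot_nth[OF assms that this] BP_nth_less[OF assms that this] show ?thesis
      by (metis fst_conv image_eqI lessThan_iff)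
  qed
  moreover have "fst (slot \<mu> x) \<in> length ` \<mu>" if "x < n" for x
    using BP_slotE[OF assms that] by (metis fst_conv image_eqI)
  ultimately show ?thesis by auto
qed

lemma block_eq_slots:
  assumes "\<mu> \<in> BP n"
  shows "(\<lambda>S. S ! (l mod length S)) ` \<mu> = {x. x < n \<and> l mod fst (slot \<mu> x) = snd (slot \<mu> x)}"
proof (intro equalityI subsetI)
  fix x assume "x \<in> (\<lambda>S. S ! (l mod length S)) ` \<mu>"
  then obtain S where S: "S \<in> \<mu>" "x = S ! (l mod length S)" by blast
  have "l mod length S < length S" using BP_D(1)[OF assms S(1)] by simp
  then show "x \<in> {x. x < n \<and> l mod fst (slot \<mu> x) = snd (slot \<mu> x)}"
    using S slot_nth[OF assms S(1)] BP_nth_less[OF assms S(1)] by simp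
next
  fix x assume "x \<in> {x. x < n \<and> l mod fst (slot \<mu> x) = snd (slot \<mu> x)}"
  then have x: "x < n" "l mod fst (slot \<mu> x) = snd (slot \<mu> x)" by auto
  from BP_slotE[OF assms x(1)] obtain S k where
    "S \<in> \<mu>" "k < length S" "x = S ! k" "slot \<mu> x = (length S, k)" .
  with x(2) show "x \<in> (\<lambda>S. S ! (l mod length S)) ` \<mu>" by auto
qed

lemma block_sequence_eq_slots:
  assumes "\<mu> \<in> BP n"
  shows "block_sequence \<mu> =
    map (\<lambda>l. {x. x < n \<and> l mod fst (slot \<mu> x) = snd (slot \<mu> x)})
      [0..<Lcm (fst ` slot \<mu> ` {..<n})]"
  unfolding block_sequence_def block_eq_slots[OF assms] length_image_eq_slots[OF assms] ..

text \<open>Each of the \<open>q\<close> intervals \<open>{t * j..<t * j + j}\<close> contains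
  exactly one such number, \<open>t * j + l\<close>, and \<open>k div j\<close> recovers
  \<open>t\<close>.\<close>

lemma card_residue_class:
  fixes j l q :: nat
  assumes "l < j"
  shows "card {k. k < j * q \<and> k mod j = l} = q"
proof -
  have "bij_betw (\<lambda>t. t * j + l) {..<q} {k. k < j * q \<and> k mod j = l}"
  proof (rule bij_betw_byWitness[where f' = "\<lambda>k. k div j"])
    show "(\<lambda>t. t * j + l) ` {..<q} \<subseteq> {k. k < j * q \<and> k mod j = l}"
    proof clarsimp
      fix t assume "t < q"
      then have "Suc t * j \<le> q * j" by (intro mult_le_mono1) simp
      then show "t * j + l < j * q \<and> l mod j = l"
        using assms by (simp add: mult.commute)
    qed
  qed (use assms in \<open>auto simp: less_mult_imp_div_less mult.commute\<close>)
  then show ?thesis using bij_betw_same_card by fastforce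
qed

text \<open>The period \<open>j\<close> is recovered from the density of the residue class, and \<open>l\<close> is a member of it.\<close>

lemma residue_class_eqD:
  fixes j l j' l' p :: nat
  assumes "l < j" "l' < j'" "j dvd p" "j' dvd p" "p > 0"
    and eq: "\<And>k. k < p \<Longrightarrow> k mod j = l \<longleftrightarrow> k mod j' = l'"
  shows "j = j' \<and> l = l'"
proof -
  obtain q where q: "p = j * q" using assms(3) by (rule dvdE)
  obtain q' where q': "p = j' * q'" using assms(4) by (rule dvdE)
  have "{k. k < j * q \<and> k mod j = l} = {k. k < j' * q' \<and> k mod j' = l'}"
    using eq unfolding q'[symmetric] q[symmetric] by blast
  then have "q = q'"
    using card_residue_class[OF assms(1)] card_residue_class[OF assms(2)] by metis
  with q q' assms(5) have j: "j = j'" by auto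
  have "l < p" using assms(1) dvd_imp_le[OF assms(3,5)] by (rule less_le_trans)
  with eq[of l] assms(1,2) j show ?thesis by simp
qed

lemma block_sequence_eq_iff:
  assumes "\<mu> \<in> BP n" "\<mu>' \<in> BP n"
  shows "block_sequence \<mu> = block_sequence \<mu>' \<longleftrightarrow> slot_word n \<mu> = slot_word n \<mu>'"
proof
  assume "slot_word n \<mu> = slot_word n \<mu>'"
  then have same: "slot \<mu> x = slot \<mu>' x" if "x < n" for x
    using that by (simp add: slot_word_def)
  then have "slot \<mu> ` {..<n} = slot \<mu>' ` {..<n}"
    by (intro image_cong) auto
  with same show "block_sequence \<mu> = block_sequence \<mu>'"
    unfolding block_sequence_eq_slots[OF assms(1)] block_sequence_eq_slots[OF assms(2)]
    by (simp cong: conj_cong)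
next
  define p where "p \<nu> = Lcm (length ` \<nu>)" for \<nu> :: "nat list set"
  assume eq: "block_sequence \<mu> = block_sequence \<mu>'"
  have len: "length (block_sequence \<nu>) = p \<nu>" for \<nu>
    by (simp add: block_sequence_def p_def)
  have p: "p \<mu> = p \<mu>'" using eq len by metis
  \<comment> \<open>The \<open>Lcm\<close> of a finite set of naturals vanishes only if the set
    contains \<open>0\<close>. A positive period ensures that there are blocks to compare.\<close>
  have "0 \<notin> length ` \<mu>" using BP_D(1)[OF assms(1)] by auto
  then have pos: "p \<mu> > 0"
    using Lcm_0_iff[OF finite_imageI[OF finite_BP[OF assms(1)]]] unfolding p_def by blast
  have mem: "x \<in> block_sequence \<nu> ! k \<longleftrightarrow> k mod fst (slot \<nu> x) = snd (slot \<nu> x)"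
    if "\<nu> \<in> BP n" "k < p \<nu>" "x < n" for \<nu> x k
    using that by (simp add: block_sequence_def p_def block_eq_slots)
  have "slot \<mu> x = slot \<mu>' x" if x: "x < n" for x
  proof -
    have *: "snd (slot \<nu> x) < fst (slot \<nu> x) \<and> fst (slot \<nu> x) dvd p \<nu>" if "\<nu> \<in> BP n" for \<nu>
    proof -
      from BP_slotE[OF that x] obtain S l where
        "S \<in> \<nu>" "l < length S" "slot \<nu> x = (length S, l)" by metis
      then show ?thesis by (simp add: p_def dvd_Lcm)
    qed
    \<comment> \<open>Both sides say that \<open>x\<close> lies in block number \<open>k\<close> of
      the common block sequence.\<close>
    have "k mod fst (slot \<mu> x) = snd (slot \<mu> x) \<longleftrightarrow> k mod fst (slot \<mu>' x) = snd (slot \<mu>' x)"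
      if "k < p \<mu>" for k
      using mem[OF assms(1) _ x, of k] mem[OF assms(2) _ x, of k] that eq p by simp
    from residue_class_eqD[OF _ _ _ _ pos this] show ?thesis
      using *[OF assms(1)] *[OF assms(2)] p by (simp add: prod_eq_iff)
  qed
  then show "slot_word n \<mu> = slot_word n \<mu>'"
    by (simp add: slot_word_def)
qed

text \<open>The equivalence classes are the fibres of \<open>slot_word n\<close> on
  \<open>BP n\<close>. Fibres over attained words are nonempty, so different words have different
  fibres.\<close>

lemma card_BP0: "card (BP0 n) = card (slot_word n ` BP n)"
proof -
  define cl where "cl w = {\<mu> \<in> BP n. slot_word n \<mu> = w}" for w
  have "equiv0 n `` {\<mu>} = cl (slot_word n \<mu>)" if "\<mu> \<in> BP n" for \<mu>
    using that block_sequence_eq_iff by (auto simp: equiv0_def cl_def)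
  then have "BP0 n = cl ` slot_word n ` BP n"
    by (auto simp: BP0_def quotient_def)
  moreover have "inj_on cl (slot_word n ` BP n)"
    by (auto simp: inj_on_def cl_def)
  ultimately show ?thesis by (simp add: card_image)
qed

section \<open>Words of slots\<close>

text \<open>This is the letter content of the slot word of any partitioned order whose o-block
  lengths form \<open>M\<close>.\<close>

definition slots :: "nat multiset \<Rightarrow> (nat \<times> nat) multiset" where
  "slots M = (\<Sum>j\<in>#M. mset (map (Pair j) [0..<j]))"

lemma slots_add_mset [simp]: "slots (add_mset j M) = mset (map (Pair j) [0..<j]) + slots M"
  by (simp add: slots_def)

lemma slots_empty [simp]: "slots {#} = {#}"
  by (simp add: slots_def)

lemma size_slots: "size (slots M) = sum_mset M"
  by (induction M) auto

text \<open>The multiplicity does not depend on \<open>l < j\<close>: this is the source of the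
  exponent \<open>j\<close> in the first formula.\<close>

lemma count_slots: "count (slots M) (j, l) = (if l < j then count M j else 0)"
proof (induction M)
  case (add i M)
  have "distinct (map (Pair i) [0..<i])" by (simp add: distinct_map inj_on_def)
  then have "count (mset (map (Pair i) [0..<i])) (j, l) = (if i = j \<and> l < j then 1 else 0)"
    by (subst distinct_count_atmost_1[THEN iffD1, rule_format]) auto
  with add show ?case by auto
qed simp

text \<open>The multiplicity of a part \<open>j > 0\<close> is that of the slot
  \<open>(j, 0)\<close>. A part \<open>0\<close> would contribute no slot and stay
  invisible.\<close>

lemma slots_inj_on: "inj_on slots {M. \<forall>k\<in>#M. k > 0}"
proof (rule inj_onI)
  fix M N assume *: "M \<in> {M. \<forall>k\<in>#M. k > 0}" "N \<in> {M. \<forall>k\<in>#M. k > 0}" "slots M = slots N"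
  show "M = N"
  proof (rule multiset_eqI)
    fix j show "count M j = count N j"
    proof (cases "j = 0")
      case True
      then have "j \<notin># M" "j \<notin># N" using * by auto
      then show ?thesis by (simp add: not_in_iff)
    next
      case False
      then show ?thesis using count_slots[of M j 0] count_slots[of N j 0] *(3) by simp
    qed
  qed
qed

text \<open>This lets the letters of a slot word be collected one o-block at a time.\<close>

lemma mset_set_UN_disjoint_lists:
  assumes "finite \<mu>" "\<forall>S\<in>\<mu>. distinct S" "pairwise (\<lambda>S T. disjnt (set S) (set T)) \<mu>"
  shows "mset_set (\<Union>S\<in>\<mu>. set S) = (\<Sum>S\<in>\<mu>. mset S)"
  using assms
proof (induction \<mu>)
  case (insert S \<mu>)
  have "set S \<inter> (\<Union>S\<in>\<mu>. set S) = {}"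
    using insert.prems insert.hyps by (auto simp: pairwise_insert disjnt_def)
  with insert show ?case
    by (simp add: mset_set_Union pairwise_insert mset_set_set)
qed simp

lemma image_mset_sum: "image_mset f (sum g A) = (\<Sum>x\<in>A. image_mset f (g x))"
  by (induction A rule: infinite_finite_induct) auto

text \<open>Along an o-block \<open>S\<close> the slots run through \<open>(length S, 0)\<close>,
  \<open>(length S, 1)\<close> and so on, which is the contribution of the part
  \<open>length S\<close>.\<close>

lemma mset_slot_word:
  assumes "\<mu> \<in> BP n"
  shows "mset (slot_word n \<mu>) = slots (image_mset length (mset_set \<mu>))"
proof -
  have "mset (slot_word n \<mu>) = image_mset (slot \<mu>) (mset_set {..<n})"
    by (simp add: slot_word_def atLeast_upt)
  also have "mset_set {..<n} = (\<Sum>S\<in>\<mu>. mset S)"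
    using mset_set_UN_disjoint_lists[OF finite_BP[OF assms]] BP_D[OF assms] by metis
  also have "image_mset (slot \<mu>) (\<Sum>S\<in>\<mu>. mset S) = (\<Sum>S\<in>\<mu>. image_mset (slot \<mu>) (mset S))"
    by (simp add: image_mset_sum)
  also have "\<dots> = (\<Sum>S\<in>\<mu>. mset (map (Pair (length S)) [0..<length S]))"
  proof (rule sum.cong[OF refl])
    fix S assume "S \<in> \<mu>"
    then have "map (slot \<mu>) S = map (Pair (length S)) [0..<length S]"
      by (intro nth_equalityI) (simp_all add: slot_nth[OF assms])
    then show "image_mset (slot \<mu>) (mset S) = mset (map (Pair (length S)) [0..<length S])"
      by (metis mset_map)
  qed
  also have "\<dots> = slots (image_mset length (mset_set \<mu>))"
    by (simp add: slots_def sum_unfold_sum_mset multiset.map_comp comp_def)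
  finally show ?thesis .
qed

text \<open>Each part of \<open>M\<close> is realised by one o-block, built greedily from unused elements.\<close>

lemma ex_partitioned_order:
  assumes "finite X" "image_mset f (mset_set X) = slots M" "\<forall>k\<in>#M. k > 0"
  shows "\<exists>\<mu>. (\<forall>S\<in>\<mu>. S \<noteq> [] \<and> distinct S) \<and> pairwise (\<lambda>S T. disjnt (set S) (set T)) \<mu> \<and>
    (\<Union>S\<in>\<mu>. set S) = X \<and> (\<forall>S\<in>\<mu>. \<forall>l<length S. f (S ! l) = (length S, l))"
  using assms
proof (induction M arbitrary: X)
  case empty
  then show ?case by (intro exI[of _ "{}"]) (auto simp: mset_set_empty_iff)
next
  case (add j M)
  have "\<exists>x\<in>X. f x = (j, l)" if "l < j" for l
  proof -
    have "(j, l) \<in># image_mset f (mset_set X)" using that add.prems by simp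
    then show ?thesis using add.prems(1) by auto
  qed
  then obtain g where g: "\<And>l. l < j \<Longrightarrow> g l \<in> X \<and> f (g l) = (j, l)" by metis
  define S where "S = map g [0..<j]"
  have S: "length S = j" "set S \<subseteq> X" "map f S = map (Pair j) [0..<j]"
    using g by (auto simp: S_def)
  \<comment> \<open>The entries chosen for the new o-block differ because their labels under
    \<open>f\<close> do.\<close>
  have "distinct (map f S)"
    unfolding S(3) by (simp add: distinct_map inj_on_def)
  then have dS: "distinct S" by (simp add: distinct_map)
  have "mset_set X = mset_set (set S) + mset_set (X - set S)"
    using add.prems(1) S(2) by (subst mset_set_Union[symmetric]) (auto simp: Un_absorb1)
  then have "image_mset f (mset_set X) = mset (map f S) + image_mset f (mset_set (X - set S))"
    by (simp add: mset_set_set dS)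
  then have "image_mset f (mset_set (X - set S)) = slots M"
    using add.prems(2) unfolding S(3) slots_add_mset by simp
  then obtain \<mu> where \<mu>: "\<forall>S\<in>\<mu>. S \<noteq> [] \<and> distinct S"
    "pairwise (\<lambda>S T. disjnt (set S) (set T)) \<mu>" "(\<Union>S\<in>\<mu>. set S) = X - set S"
    "\<forall>S\<in>\<mu>. \<forall>l<length S. f (S ! l) = (length S, l)"
    using add.IH[of "X - set S"] add.prems by auto
  have "S \<noteq> []" using S(1) add.prems(3) by auto
  moreover have "disjnt (set S) (set T)" if "T \<in> \<mu>" for T
    using \<mu>(3) that by (auto simp: disjnt_def)
  moreover have "\<forall>l<length S. f (S ! l) = (length S, l)"
    using g by (simp add: S_def)
  ultimately show ?case
    using \<mu> dS S(2) by (intro exI[of _ "insert S \<mu>"]) (auto simp: pairwise_insert disjnt_sym)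
qed

text \<open>In one direction the partition consists of the o-block lengths. In the other,
  \<open>ex_partitioned_order\<close> with the labelling \<open>f = (!) w\<close> yields a
  partitioned order in which each \<open>x < n\<close> has slot \<open>w ! x\<close>.\<close>

lemma slot_word_image_BP:
  "slot_word n ` BP n = (\<Union>M\<in>integer_partitions n. permutations_of_multiset (slots M))"
proof (intro equalityI subsetI)
  fix w assume "w \<in> slot_word n ` BP n"
  then obtain \<mu> where \<mu>: "\<mu> \<in> BP n" "w = slot_word n \<mu>" by blast
  define M where "M = image_mset length (mset_set \<mu>)"
  have w: "mset w = slots M" using mset_slot_word \<mu> by (simp add: M_def)
  have "sum_mset M = length w" using w size_slots by (metis size_mset)
  then have "M \<in> integer_partitions n"
    using \<mu> BP_D(1)[OF \<mu>(1)] finite_BP[OF \<mu>(1)]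
    by (auto simp: integer_partitions_def M_def slot_word_def)
  with w show "w \<in> (\<Union>M\<in>integer_partitions n. permutations_of_multiset (slots M))"
    by (auto intro: permutations_of_multisetI)
next
  fix w assume "w \<in> (\<Union>M\<in>integer_partitions n. permutations_of_multiset (slots M))"
  then obtain M where M: "\<forall>k\<in>#M. k > 0" "sum_mset M = n" "mset w = slots M"
    by (auto simp: integer_partitions_def dest: permutations_of_multisetD)
  have len: "length w = n" using M size_slots by (metis size_mset)
  have "image_mset ((!) w) (mset_set {..<n}) = mset (map ((!) w) [0..<length w])"
    by (simp add: atLeast_upt len)
  then have "image_mset ((!) w) (mset_set {..<n}) = slots M"
    unfolding map_nth M(3) .
  from ex_partitioned_order[OF _ this M(1)] obtain \<mu> where \<mu>: "\<mu> \<in> BP n"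
    "\<And>S l. S \<in> \<mu> \<Longrightarrow> l < length S \<Longrightarrow> w ! (S ! l) = (length S, l)"
    by (auto simp: BP_def)
  have "slot \<mu> x = w ! x" if "x < n" for x
    using BP_slotE[OF \<mu>(1) that] \<mu>(2) by metis
  then have "slot_word n \<mu> = w"
    by (intro nth_equalityI) (simp_all add: slot_word_def len)
  with \<mu>(1) show "w \<in> slot_word n ` BP n" by blast
qed

text \<open>The union is disjoint: a word determines its multiset of letters, and this determines
  the partition.\<close>

lemma card_BP0_eq_sum:
  "card (BP0 n) = (\<Sum>M\<in>integer_partitions n. card (permutations_of_multiset (slots M)))"
  unfolding card_BP0 slot_word_image_BP
proof (rule card_UN_disjoint[OF finite_integer_partitions])
  show "\<forall>M\<in>integer_partitions n. \<forall>N\<in>integer_partitions n. M \<noteq> N \<longrightarrow>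
    permutations_of_multiset (slots M) \<inter> permutations_of_multiset (slots N) = {}"
    using slots_inj_on by (auto simp: inj_on_def integer_partitions_def
        dest!: permutations_of_multisetD)
qed simp

section \<open>Multinomial coefficients\<close>

text \<open>The multinomial coefficient in multiplied form, which avoids division of naturals;
  \<open>d\<close> may be any bound on the parts.\<close>

lemma card_permutations_of_slots:
  assumes "\<forall>k\<in>#M. 0 < k \<and> k \<le> d"
  shows "card (permutations_of_multiset (slots M)) * (\<Prod>j=1..d. fact (count M j) ^ j) =
    fact (sum_mset M)"
proof -
  have sub: "set_mset (slots M) \<subseteq> Sigma {1..d} lessThan"
  proof
    fix p assume "p \<in># slots M"
    then obtain j l where p: "p = (j, l)" "count (slots M) (j, l) > 0" by (cases p) auto
    then have "l < j" "j \<in># M" by (auto simp: count_slots split: if_splits)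
    with p assms show "p \<in> Sigma {1..d} lessThan" by auto
  qed
  \<comment> \<open>Slots that do not occur may be added to the index set, since they contribute
    \<open>fact 0 = 1\<close>.\<close>
  have "(\<Prod>p\<in>set_mset (slots M). fact (count (slots M) p)) =
      (\<Prod>p\<in>Sigma {1..d} lessThan. fact (count (slots M) p) :: nat)"
    by (rule prod.mono_neutral_left) (use sub in \<open>auto simp: not_in_iff\<close>)
  also have "\<dots> = (\<Prod>j=1..d. \<Prod>l<j. fact (count (slots M) (j, l)))"
    by (subst prod.Sigma) (auto intro!: prod.cong)
  also have "\<dots> = (\<Prod>j=1..d. fact (count M j) ^ j)"
    by (intro prod.cong refl) (simp add: count_slots)
  finally show ?thesis
    using card_permutations_of_multiset_aux[of "slots M"] by (simp add: size_slots)
qed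

text \<open>Choosing \<open>j\<close> successive groups of size \<open>a\<close> from
  \<open>N\<close> elements telescopes: each choice turns the factorial of the remaining number into
  \<open>fact a\<close> times the next one. The hypothesis keeps the subtractions from
  truncating.\<close>

lemma prod_choose_iterate:
  fixes a N j :: nat
  assumes "j * a \<le> N"
  shows "(\<Prod>l=1..j. (N - (l - 1) * a) choose a) * fact a ^ j * fact (N - j * a) = (fact N :: nat)"
  using assms
proof (induction j)
  case (Suc j)
  have *: "a \<le> N - j * a" using Suc.prems by simp
  have "(\<Prod>l=1..Suc j. (N - (l - 1) * a) choose a) * fact a ^ Suc j * fact (N - Suc j * a) =
      (\<Prod>l=1..j. (N - (l - 1) * a) choose a) * fact a ^ j *
      (fact a * fact (N - j * a - a) * ((N - j * a) choose a))"
    by (simp add: diff_diff_left add.commute mult.assoc mult.left_commute mult.commute)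
  also have "fact a * fact (N - j * a - a) * ((N - j * a) choose a) = fact (N - j * a)"
    by (rule binomial_fact_lemma[OF *])
  also have "(\<Prod>l=1..j. (N - (l - 1) * a) choose a) * fact a ^ j * fact (N - j * a) = fact N"
    using Suc.prems by (intro Suc.IH) simp
  finally show ?case .
qed simp

text \<open>The right side first selects all \<open>j * a\<close> elements and then splits them into
  groups. Multiplied by \<open>fact a ^ j * fact (N - j * a)\<close>, both sides become
  \<open>fact N\<close>.\<close>

lemma prod_choose_eq_choose_mult:
  fixes a N j :: nat
  assumes "j * a \<le> N"
  shows "(\<Prod>l=1..j. (N - (l - 1) * a) choose a) =
    (N choose (j * a)) * (\<Prod>l=1..j. ((j - l + 1) * a) choose a)"
proof -
  let ?Q = "\<Prod>l=1..j. ((j - l + 1) * a) choose a"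
  \<comment> \<open>With \<open>j * a\<close> elements available nothing is left over after
    \<open>j\<close> choices, so the remaining factorial is \<open>fact 0\<close>.\<close>
  have "?Q = (\<Prod>l=1..j. (j * a - (l - 1) * a) choose a)"
    by (intro prod.cong refl) (simp add: Suc_diff_le flip: diff_mult_distrib)
  then have Q: "?Q * fact a ^ j = fact (j * a)"
    using prod_choose_iterate[of j a "j * a"] by simp
  have "(N choose (j * a)) * ?Q * (fact a ^ j * fact (N - j * a)) =
      (?Q * fact a ^ j) * fact (N - j * a) * (N choose (j * a))"
    by (simp add: ac_simps)
  also have "\<dots> = fact N"
    unfolding Q by (rule binomial_fact_lemma[OF assms])
  also have "\<dots> = (\<Prod>l=1..j. (N - (l - 1) * a) choose a) * (fact a ^ j * fact (N - j * a))"
    using prod_choose_iterate[OF assms] by (simp add: mult.assoc)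
  finally show ?thesis by simp
qed

text \<open>A second telescoping, over the part sizes: size \<open>j\<close> uses up
  \<open>j * m j\<close> of the remaining elements.\<close>

lemma prod_prod_choose:
  fixes m :: "nat \<Rightarrow> nat"
  assumes "(\<Sum>k=1..d. k * m k) \<le> n"
  shows "(\<Prod>j=1..d. \<Prod>l=1..j. (n - (\<Sum>k=1..j-1. k * m k) - (l - 1) * m j) choose (m j)) *
    (\<Prod>j=1..d. fact (m j) ^ j) * fact (n - (\<Sum>k=1..d. k * m k)) = (fact n :: nat)"
  using assms
proof (induction d)
  case (Suc d)
  let ?s = "\<Sum>k=1..d. k * m k"
  let ?P = "\<lambda>j. \<Prod>l=1..j. (n - (\<Sum>k=1..j-1. k * m k) - (l - 1) * m j) choose (m j)"
  have le: "Suc d * m (Suc d) \<le> n - ?s" using Suc.prems by simp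
  have "prod ?P {1..Suc d} * (\<Prod>j=1..Suc d. fact (m j) ^ j) *
        fact (n - (\<Sum>k=1..Suc d. k * m k)) =
      prod ?P {1..d} * (\<Prod>j=1..d. fact (m j) ^ j) *
      (?P (Suc d) * fact (m (Suc d)) ^ Suc d * fact (n - ?s - Suc d * m (Suc d)))"
    by (simp del: power_Suc mult_Suc add: ac_simps)
  also have "?P (Suc d) * fact (m (Suc d)) ^ Suc d * fact (n - ?s - Suc d * m (Suc d)) =
      fact (n - ?s)"
    using prod_choose_iterate[OF le] by simp
  also have "prod ?P {1..d} * (\<Prod>j=1..d. fact (m j) ^ j) * fact (n - ?s) = fact n"
    using Suc.prems by (intro Suc.IH) simp
  finally show ?case .
qed simp

lemma sum_count_eq_sum_mset:
  fixes M :: "nat multiset"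
  assumes "\<forall>k\<in>#M. 0 < k \<and> k \<le> d"
  shows "(\<Sum>k=1..d. k * count M k) = sum_mset M"
  using assms
proof (induction M)
  case (add j M)
  have "(\<Sum>k=1..d. k * count (add_mset j M) k) =
      (\<Sum>k=1..d. (if k = j then j else 0) + k * count M k)"
    by (intro sum.cong) auto
  with add show ?case by (auto simp: sum.distrib)
qed simp

lemma integer_partitions_le_max_part:
  assumes "M \<in> integer_partitions n"
  shows "\<forall>k\<in>#M. 0 < k \<and> k \<le> max_part M"
  using assms by (auto simp: integer_partitions_def max_part_def)

theorem theorem2:
  fixes n :: nat and P :: "nat \<Rightarrow> nat multiset"
    and d :: "nat \<Rightarrow> nat" and m :: "nat \<Rightarrow> nat \<Rightarrow> nat"
  assumes "n \<ge> 1"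
    and "partition_listing n P"
    and "\<And>i. i \<in> {1..num_partitions n} \<Longrightarrow> d i = max_part (P i)"
    and "\<And>i j. i \<in> {1..num_partitions n} \<Longrightarrow> m i j = count (P i) j"
  shows "real (card (BP0 n)) =
           (\<Sum>i=1..num_partitions n. fact n / (\<Prod>j=1..d i. fact (m i j) ^ j)) \<and>
         (\<Sum>i=1..num_partitions n. fact n / (\<Prod>j=1..d i. fact (m i j) ^ j)) =
         real (\<Sum>i=1..num_partitions n. \<Prod>j=1..d i. \<Prod>l=1..j.
           (n - (\<Sum>k=1..j-1. k * m i k) - (l - 1) * m i j) choose (m i j)) \<and>
         (\<Sum>i=1..num_partitions n. \<Prod>j=1..d i. \<Prod>l=1..j.
           (n - (\<Sum>k=1..j-1. k * m i k) - (l - 1) * m i j) choose (m i j)) =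
         (\<Sum>i=1..num_partitions n. \<Prod>j=1..d i.
           ((n - (\<Sum>k=1..j-1. k * m i k)) choose (j * m i j)) *
           (\<Prod>l=1..j. ((j - l + 1) * m i j) choose (m i j)))"
proof (intro conjI)
  let ?I = "{1..num_partitions n}"
  let ?F = "\<lambda>i. \<Prod>j=1..d i. fact (m i j) ^ j"
  let ?B = "\<lambda>i j. \<Prod>l=1..j. (n - (\<Sum>k=1..j-1. k * m i k) - (l - 1) * m i j) choose (m i j)"
  have P: "bij_betw P ?I (integer_partitions n)"
    using assms(2) by (simp add: partition_listing_def)
  have le: "\<forall>k\<in>#P i. 0 < k \<and> k \<le> d i" and sum: "sum_mset (P i) = n" if "i \<in> ?I" for i
    using integer_partitions_le_max_part[of "P i" n] bij_betwE[OF P] that assms(3)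
    by (auto simp: integer_partitions_def)
  have weight: "(\<Sum>k=1..d i. k * m i k) = n" if "i \<in> ?I" for i
    using sum_count_eq_sum_mset[OF le[OF that]] sum[OF that] assms(4)[OF that] by simp
  \<comment> \<open>\<open>?F i\<close> is a natural number in the premise and a real number in the
    conclusion. The rule serves both the permutation count and the binomial product.\<close>
  have quot: "real c = fact n / ?F i" if "c * ?F i = fact n" for c i
  proof -
    have "real c * ?F i = fact n"
      using arg_cong[OF that, of real] by (simp add: of_nat_prod)
    then show ?thesis by (simp add: field_simps)
  qed
  have "card (BP0 n) = (\<Sum>i\<in>?I. card (permutations_of_multiset (slots (P i))))"
    unfolding card_BP0_eq_sum by (rule sum.reindex_bij_betw[OF P, symmetric])
  moreover have "real (card (permutations_of_multiset (slots (P i)))) = fact n / ?F i"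
    if "i \<in> ?I" for i
    using card_permutations_of_slots[OF le[OF that]] sum[OF that] assms(4)[OF that]
    by (intro quot) simp
  ultimately show "real (card (BP0 n)) = (\<Sum>i\<in>?I. fact n / ?F i)"
    by simp
  \<comment> \<open>By \<open>weight\<close> the parts use up all \<open>n\<close> elements, so the
    leftover factorial in \<open>prod_prod_choose\<close> is \<open>fact 0\<close>.\<close>
  have "real (\<Prod>j=1..d i. ?B i j) = fact n / ?F i" if "i \<in> ?I" for i
    using prod_prod_choose[of "m i" "d i" n] weight[OF that] by (intro quot) simp
  then show "(\<Sum>i\<in>?I. fact n / ?F i) = real (\<Sum>i\<in>?I. \<Prod>j=1..d i. ?B i j)"
    unfolding of_nat_sum by (intro sum.cong refl) simp
  show "(\<Sum>i\<in>?I. \<Prod>j=1..d i. ?B i j) = (\<Sum>i\<in>?I. \<Prod>j=1..d i.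
      ((n - (\<Sum>k=1..j-1. k * m i k)) choose (j * m i j)) *
      (\<Prod>l=1..j. ((j - l + 1) * m i j) choose (m i j)))"
  proof (intro sum.cong prod.cong refl prod_choose_eq_choose_mult)
    fix i j assume i: "i \<in> ?I" and j: "j \<in> {1..d i}"
    \<comment> \<open>The parts of size at most \<open>j\<close> have total at most
      \<open>n\<close>, so after the smaller parts there is still room for those of size
      \<open>j\<close>.\<close>
    have "(\<Sum>k=1..j. k * m i k) \<le> n"
      unfolding weight[OF i, symmetric] using j by (intro sum_mono2) auto
    moreover have "(\<Sum>k=1..j. k * m i k) = (\<Sum>k=1..j-1. k * m i k) + j * m i j"
      using j by (cases j) auto
    ultimately show "j * m i j \<le> n - (\<Sum>k=1..j-1. k * m i k)" by simp
  qed
qed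

end
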